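(* Let $A$ be an $n\times n$ matrix in normal form over $S$, where $S$ is $\mathbb{T}$ or $R$, and let $k$ be a natural number such that $k\ge n-1$. Then $A^{\nabla}=A^{k}$. In particular, $A^{k}=A^{k+1}$ for all $k\ge n-1$. Here the equalities are equalities of matrices if $S=\mathbb{T}$, and are interpreted as entrywise $\nu$-equivalence $\cong_{\nu}$ if $S=R$.
   Context: Let $\mathcal{G}$ be a totally ordered abelian group, e.g. $(\mathbb{R},+)$ or $(\mathbb{Q},+)$. The tropical semifield is $\mathbb{T}=\mathcal{G}\cup\{-\infty\}$ with addition $\max$ and multiplication the group operation; its zero is $-\infty$ and its one $1_{\mathbb{T}}$ is the identity of $\mathcal{G}$. The supertropical semiring is $R=\mathcal{G}\cup\mathcal{G}^{\nu}\cup\{-\infty\}$, where $\mathcal{G}$ is the set of tangible elements and $\mathcal{G}^{\nu}=\{a^{\nu}:a\in\mathcal{G}\}$ is a disjoint ordered copy of $\mathcal{G}$ (the ghost elements). Put $(a^{\nu})^{\nu}=a^{\nu}$ and $(-\infty)^\nu=-\infty$; elements are compared through their $\nu$-values $a^\nu$, and $a\cong_\nu b$ means $a^\nu=b^\nu$. Addition: $a+b$ is the one of larger $\nu$-value if $a^{\nu}\ne b^{\nu}$, and $a+b=a^{\nu}$ if $a^{\nu}=b^{\nu}$. Multiplication is the group operation on the underlying elements of $\mathcal{G}$, the product being ghost if at least one factor is ghost; $-\infty$ is additively neutral and multiplicatively absorbing. $0_R=-\infty$, and $1_R$ is the (tangible) identity of $\mathcal{G}$. For $A=(a_{i,j})\in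 M_n(S)$, $\det(A)=\sum_{\sigma\in S_n}a_{1,\sigma(1)}\cdots a_{n,\sigma(n)}$ (the permanent). The adjoint $\mathrm{adj}(A)$ has $(i,j)$ entry $\det(A_{j,i})$, where $A_{j,i}$ is $A$ with row $j$ and column $i$ deleted (the empty determinant is $1_S$). When $\det(A)$ is invertible (in $\mathcal{G}$), $A^{\nabla}=\det(A)^{-1}\mathrm{adj}(A)$. A matrix over $S$ is in normal form if all its diagonal entries are $1_S$ and its determinant is $1_S$. (Over $\mathbb{T}$: every product $a_{1,\sigma(1)}\cdots a_{n,\sigma(n)}$ is $\le 1_{\mathbb{T}}$; over $R$: every such product with $\sigma\ne\mathrm{Id}$ has $\nu$-value strictly smaller than that of $1_R$.) Powers are matrix powers over $S$, with $A^0=I$. *)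

theory Defs
  imports "Jordan_Normal_Form.Determinant"
begin

section \<open>The tropical semifield\<close>

datatype 'g tropical = Fin 'g | MInf

instantiation tropical :: (linorder) linorder
begin

fun less_eq_tropical :: "'a tropical \<Rightarrow> 'a tropical \<Rightarrow> bool" where
  "MInf \<le> y \<longleftrightarrow> True"
| "Fin a \<le> MInf \<longleftrightarrow> False"
| "Fin a \<le> Fin b \<longleftrightarrow> a \<le> b"

definition less_tropical :: "'a tropical \<Rightarrow> 'a tropical \<Rightarrow> bool" where
  "x < y \<longleftrightarrow> x \<le> y \<and> \<not> y \<le> (x :: 'a tropical)"

instance
proof
  fix x y z :: "'a tropical"
  show "x < y \<longleftrightarrow> x \<le> y \<and> \<not> y \<le> x" by (simp add: less_tropical_def)
  show "x \<le> x" by (cases x) auto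
  show "x \<le> y \<Longrightarrow> y \<le> z \<Longrightarrow> x \<le> z" by (cases x; cases y; cases z) auto
  show "x \<le> y \<Longrightarrow> y \<le> x \<Longrightarrow> x = y" by (cases x; cases y) auto
  show "x \<le> y \<or> y \<le> x" by (cases x; cases y) auto
qed

end

lemma less_tropical_simps [simp]:
  "\<not> x < MInf" "MInf < Fin a" "Fin a < Fin b \<longleftrightarrow> a < b"
  by (cases x) (auto simp: less_tropical_def)

instantiation tropical :: (linordered_ab_group_add) comm_semiring_1
begin

definition zero_tropical :: "'a tropical" where "0 = MInf"

definition one_tropical :: "'a tropical" where "1 = Fin 0"

definition plus_tropical :: "'a tropical \<Rightarrow> 'a tropical \<Rightarrow> 'a tropical" where
  "x + y = max x (y :: 'a tropical)"

fun times_tropical :: "'a tropical \<Rightarrow> 'a tropical \<Rightarrow> 'a tropical" where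
  "Fin a * Fin b = Fin (a + b)"
| "MInf * y = MInf"
| "Fin a * MInf = MInf"

instance
proof
  fix x y z :: "'a tropical"
  show "x * y * z = x * (y * z)" by (cases x; cases y; cases z) (auto simp: add.assoc)
  show "x * y = y * x" by (cases x; cases y) (auto simp: add.commute)
  show "1 * x = x" by (cases x) (auto simp: one_tropical_def)
  show "x + y + z = x + (y + z)" by (simp add: plus_tropical_def max.assoc)
  show "x + y = y + x" by (simp add: plus_tropical_def max.commute)
  show "0 + x = x" by (cases x) (auto simp: plus_tropical_def zero_tropical_def max_def)
  show "0 * x = 0" by (simp add: zero_tropical_def)
  show "x * 0 = 0" by (cases x) (auto simp: zero_tropical_def)
  show "(x + y) * z = x * z + y * z"
    by (cases x; cases y; cases z) (auto simp: plus_tropical_def max_def)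
  show "(0 :: 'a tropical) \<noteq> 1" by (simp add: zero_tropical_def one_tropical_def)
qed

end


section \<open>The supertropical semiring\<close>

datatype 'g supertropical = Tangible 'g | Ghost 'g | NegInf

fun nu :: "'g supertropical \<Rightarrow> 'g supertropical" where
  "nu (Tangible a) = Ghost a"
| "nu (Ghost a) = Ghost a"
| "nu NegInf = NegInf"

definition nu_equiv :: "'g supertropical \<Rightarrow> 'g supertropical \<Rightarrow> bool" (infix "\<cong>\<nu>" 50) where
  "x \<cong>\<nu> y \<longleftrightarrow> nu x = nu y"

text \<open>The ordered set of \<open>\<nu>\<close>-values, i.e. the ghosts together with \<open>-\<infinity>\<close>, is an ordered
  copy of the tropical semifield. \<open>nu_level x\<close> is the element of this copy that corresponds
  to \<open>nu x\<close>; it serves to compare \<open>\<nu>\<close>-values.\<close>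

fun nu_level :: "'g supertropical \<Rightarrow> 'g tropical" where
  "nu_level (Tangible a) = Fin a"
| "nu_level (Ghost a) = Fin a"
| "nu_level NegInf = MInf"

lemma nu_eq_iff_nu_level_eq: "nu x = nu y \<longleftrightarrow> nu_level x = nu_level y"
  by (cases x; cases y) auto

instantiation supertropical :: (linordered_ab_group_add) comm_semiring_1
begin

definition zero_supertropical :: "'a supertropical" where "0 = NegInf"

definition one_supertropical :: "'a supertropical" where "1 = Tangible 0"

definition plus_supertropical ::
  "'a supertropical \<Rightarrow> 'a supertropical \<Rightarrow> 'a supertropical" where
  "x + y = (if nu x = nu y then nu x
            else if nu_level x < nu_level y then y else x)"

fun times_supertropical ::
  "'a supertropical \<Rightarrow> 'a supertropical \<Rightarrow> 'a supertropical" where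
  "Tangible a * Tangible b = Tangible (a + b)"
| "Tangible a * Ghost b = Ghost (a + b)"
| "Ghost a * Tangible b = Ghost (a + b)"
| "Ghost a * Ghost b = Ghost (a + b)"
| "NegInf * y = NegInf"
| "Tangible a * NegInf = NegInf"
| "Ghost a * NegInf = NegInf"

instance
proof
  fix x y z :: "'a supertropical"
  show "x * y * z = x * (y * z)" by (cases x; cases y; cases z) (auto simp: add.assoc)
  show "x * y = y * x" by (cases x; cases y) (auto simp: add.commute)
  show "1 * x = x" by (cases x) (auto simp: one_supertropical_def)
  show "x + y + z = x + (y + z)"
    by (cases x; cases y; cases z) (auto simp: plus_supertropical_def)
  show "x + y = y + x" by (cases x; cases y) (auto simp: plus_supertropical_def)
  show "0 + x = x" by (cases x) (auto simp: plus_supertropical_def zero_supertropical_def)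
  show "0 * x = 0" by (simp add: zero_supertropical_def)
  show "x * 0 = 0" by (cases x) (auto simp: zero_supertropical_def)
  show "(x + y) * z = x * z + y * z"
    by (cases x; cases y; cases z) (auto simp: plus_supertropical_def)
  show "(0 :: 'a supertropical) \<noteq> 1"
    by (simp add: zero_supertropical_def one_supertropical_def)
qed

end


section \<open>Matrices over a commutative semiring\<close>

text \<open>The library determinant \<open>det\<close> needs a ring; here no signs occur.\<close>

definition trop_det :: "'a :: comm_semiring_1 mat \<Rightarrow> 'a" where
  "trop_det A = (\<Sum>p | p permutes {0..<dim_row A}. \<Prod>i = 0..<dim_row A. A $$ (i, p i))"

definition trop_adj :: "'a :: comm_semiring_1 mat \<Rightarrow> 'a mat" where
  "trop_adj A = mat (dim_row A) (dim_col A) (\<lambda>(i, j). trop_det (mat_delete A j i))"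

text \<open>Meaningful only for invertible \<open>a\<close>. In both semirings the invertible elements are
  exactly the elements of the underlying group, see below.\<close>

definition mult_inverse :: "'a :: comm_semiring_1 \<Rightarrow> 'a" where
  "mult_inverse a = (THE b. a * b = 1)"

definition nabla :: "'a :: comm_semiring_1 mat \<Rightarrow> 'a mat" where
  "nabla A = mult_inverse (trop_det A) \<cdot>\<^sub>m trop_adj A"

definition normal_form :: "'a :: comm_semiring_1 mat \<Rightarrow> bool" where
  "normal_form A \<longleftrightarrow> square_mat A \<and> (\<forall>i < dim_row A. A $$ (i, i) = 1) \<and> trop_det A = 1"

definition mat_nu_equiv :: "'g supertropical mat \<Rightarrow> 'g supertropical mat \<Rightarrow> bool"
    (infix "\<cong>\<nu>\<^sub>m" 50) where
  "A \<cong>\<nu>\<^sub>m B \<longleftrightarrow> dim_row A = dim_row B \<and> dim_col A = dim_col B \<and>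
     (\<forall>i < dim_row A. \<forall>j < dim_col A. A $$ (i, j) \<cong>\<nu> B $$ (i, j))"

lemma mult_inverse_eqI: "a * b = 1 \<Longrightarrow> mult_inverse a = b"
  unfolding mult_inverse_def
  by (rule the_equality) (metis mult.assoc mult.commute mult_1_left)+

lemma mult_inverse_Fin:
  "mult_inverse (Fin (a :: 'g :: linordered_ab_group_add)) = Fin (- a)"
  by (rule mult_inverse_eqI) (simp add: one_tropical_def)

lemma mult_inverse_Tangible:
  "mult_inverse (Tangible (a :: 'g :: linordered_ab_group_add)) = Tangible (- a)"
  by (rule mult_inverse_eqI) (simp add: one_supertropical_def)

lemma invertible_tropical_iff:
  "x dvd 1 \<longleftrightarrow> (\<exists>a. x = Fin (a :: 'g :: linordered_ab_group_add))"
proof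
  assume "x dvd 1"
  then show "\<exists>a. x = Fin a"
    by (cases x) (auto simp: dvd_def one_tropical_def)
next
  assume "\<exists>a. x = Fin a"
  then obtain a where "x = Fin a" by blast
  then have "1 = x * Fin (- a)" by (simp add: one_tropical_def)
  then show "x dvd 1" by (rule dvdI)
qed

lemma invertible_supertropical_iff:
  "x dvd 1 \<longleftrightarrow> (\<exists>a. x = Tangible (a :: 'g :: linordered_ab_group_add))"
proof
  assume "x dvd 1"
  then obtain y where "1 = x * y" by (rule dvdE)
  then show "\<exists>a. x = Tangible a"
    by (cases x; cases y) (auto simp: one_supertropical_def)
next
  assume "\<exists>a. x = Tangible a"
  then obtain a where "x = Tangible a" by blast
  then have "1 = x * Tangible (- a)" by (simp add: one_supertropical_def)
  then show "x dvd 1" by (rule dvdI)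
qed

end

theory Submission
  imports Defs "HOL-Combinatorics.Cycles"
begin

text \<open>
  The entry \<open>(i, j)\<close> of \<open>A\<^sup>k\<close> is the maximal weight of a walk of length \<open>k\<close> from \<open>i\<close> to \<open>j\<close>, and the
  entry \<open>(i, j)\<close> of the adjoint is the maximal weight of a permutation sending \<open>j\<close> to \<open>i\<close>, with the
  edge at \<open>j\<close> omitted. The normal form says that closed cycles have weight at most \<open>1\<close> and loops have
  weight \<open>1\<close>. Removing cycles bounds a walk by a simple path, which is turned into a permutation by
  closing it up and adding loops. Conversely, a permutation sending \<open>j\<close> to \<open>i\<close> consists of a path
  from \<open>i\<close> to \<open>j\<close> with at most \<open>n - 1\<close> edges, which the loops extend to any larger length, and of
  further cycles of weight at most \<open>1\<close>. The supertropical case follows by applying the semiring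
  homomorphism \<open>nu_level\<close>.
\<close>

section \<open>The tropical semifield as an ordered semiring\<close>

instance tropical :: (linordered_ab_group_add) canonically_ordered_monoid_add
proof
  fix a b :: "'a tropical"
  show "a \<le> b \<longleftrightarrow> (\<exists>c. b = a + c)"
    by (metis max.cobounded1 max_def plus_tropical_def)
qed

instance tropical :: (linordered_ab_group_add) ordered_comm_semiring
proof
  fix a b c :: "'a tropical"
  assume "a \<le> b"
  then have "a + b = b"
    by (simp add: plus_tropical_def max_def)
  then show "c * a \<le> c * b"
    by (metis distrib_left le_iff_add)
qed

text \<open>The sum is a maximum; over an empty or infinite index set it is -infinity, which lies
  below every \<open>b\<close>.\<close>

lemma tropical_sum_le:
  fixes f :: "'b \<Rightarrow> 'g :: linordered_ab_group_add tropical"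
  assumes "\<And>x. x \<in> S \<Longrightarrow> f x \<le> b"
  shows "sum f S \<le> b"
  using assms by (induction S rule: infinite_finite_induct) (auto simp: plus_tropical_def)

lemma tropical_sum_attained:
  fixes f :: "'b \<Rightarrow> 'g :: linordered_ab_group_add tropical"
  assumes "finite S" "S \<noteq> {}"
  obtains x where "x \<in> S" "sum f S = f x"
proof -
  have "\<exists>x\<in>S. sum f S = f x"
    using assms
  proof (induction S rule: finite_ne_induct)
    case (insert x S)
    then show ?case
      by (auto simp: plus_tropical_def max_def)
  qed simp
  then show ?thesis
    using that by blast
qed

section \<open>The adjoint as a sum over permutations\<close>

lemma nabla_eq_adj:
  fixes A :: "'a :: comm_semiring_1 mat"
  assumes "normal_form A"
  shows "nabla A = trop_adj A"
proof -
  have "mult_inverse (1 :: 'a) = 1"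
    by (rule mult_inverse_eqI) simp
  then show ?thesis
    using assms by (auto simp: nabla_def normal_form_def)
qed

text \<open>\<open>permutation_insert j i\<close> is a bijection from the permutations of n - 1
  indices onto those of n indices that send \<open>j\<close> to \<open>i\<close>; the factor of row
  \<open>j\<close> is the one left out.\<close>

lemma trop_det_mat_delete:
  fixes A :: "'a :: comm_semiring_1 mat"
  assumes A: "A \<in> carrier_mat n n" and i: "i < n" and j: "j < n"
  shows "trop_det (mat_delete A j i) =
    (\<Sum>p | p permutes {0..<n} \<and> p j = i. \<Prod>r\<in>{0..<n} - {j}. A $$ (r, p r))"
proof -
  obtain m where n: "n = Suc m"
    using i by (cases n) auto
  have dim: "dim_row (mat_delete A j i) = m"
    using A n by simp
  have prod: "(\<Prod>r\<in>{0..<n} - {j}. A $$ (r, permutation_insert j i p r)) =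
      (\<Prod>r = 0..<m. mat_delete A j i $$ (r, p r))" if p: "p permutes {0..<m}" for p
  proof -
    have "(\<Prod>r\<in>{0..<n} - {j}. A $$ (r, permutation_insert j i p r)) =
        (\<Prod>r\<in>insert_index j ` {0..<m}. A $$ (r, permutation_insert j i p r))"
      using insert_index_image[of j m] j n by simp
    also have "\<dots> = (\<Prod>r = 0..<m.
        A $$ (insert_index j r, permutation_insert j i p (insert_index j r)))"
      using insert_index_inj_on[of j "{0..<m}"] by (simp add: prod.reindex)
    also have "\<dots> = (\<Prod>r = 0..<m. A $$ (insert_index j r, insert_index i (p r)))"
      by (intro prod.cong) (auto simp: permutation_insert_expand insert_index_def)
    also have "\<dots> = (\<Prod>r = 0..<m. mat_delete A j i $$ (r, p r))"
      using A i j n permutes_in_image[OF p]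
      by (intro prod.cong) (auto simp: mat_delete_index[of A m j i])
    finally show ?thesis .
  qed
  have "(\<Sum>p | p permutes {0..<n} \<and> p j = i. \<Prod>r\<in>{0..<n} - {j}. A $$ (r, p r)) =
      (\<Sum>p | p permutes {0..<m}. \<Prod>r\<in>{0..<n} - {j}. A $$ (r, permutation_insert j i p r))"
    using i j n permutation_fix[of j m i] permutation_insert_inj_on[of j m i]
    by (simp add: sum.reindex)
  then show ?thesis
    by (simp add: trop_det_def dim prod del: mat_delete_dim)
qed

section \<open>Walks as vertex lists, and cycles of permutations\<close>

fun path_weight :: "'a :: monoid_mult mat \<Rightarrow> nat list \<Rightarrow> 'a" where
  "path_weight A (x # y # zs) = A $$ (x, y) * path_weight A (y # zs)"
| "path_weight A _ = 1"

text \<open>A walk is cut at the vertex \<open>y\<close>, which both pieces keep as an endpoint, so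
  that no edge is lost.\<close>

lemma path_weight_append:
  "path_weight A (xs @ y # zs) = path_weight A (xs @ [y]) * path_weight A (y # zs)"
proof (induction xs)
  case (Cons x xs)
  then show ?case
    by (cases xs) (simp_all add: mult.assoc)
qed simp

lemma path_weight_snoc:
  assumes "xs \<noteq> []"
  shows "path_weight A (xs @ [y]) = path_weight A xs * A $$ (last xs, y)"
  using path_weight_append[of A "butlast xs" "last xs" "[y]"] assms
  by (cases xs rule: rev_cases) simp_all

text \<open>On a simple path each vertex except the last starts exactly one edge. This makes a path
  weight part of a permutation weight.\<close>

lemma path_weight_eq_prod:
  fixes A :: "'a :: comm_semiring_1 mat"
  assumes "distinct xs" "successively (\<lambda>x y. p x = y) xs" "xs \<noteq> []"
  shows "path_weight A xs = (\<Prod>r\<in>set xs - {last xs}. A $$ (r, p r))"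
  using assms
proof (induction xs rule: induct_list012)
  case (3 x y zs)
  have "set (x # y # zs) - {last (x # y # zs)} = insert x (set (y # zs) - {last (y # zs)})"
    using 3(3) by auto
  moreover have "x \<notin> set (y # zs) - {last (y # zs)}"
    using 3(3) by auto
  ultimately show ?case
    using 3 by simp
qed simp_all

lemma cycle_of_list_successively:
  assumes "distinct xs" "xs \<noteq> []"
  shows "successively (\<lambda>x y. cycle_of_list xs x = y) xs"
    and "cycle_of_list xs (last xs) = hd xs"
proof -
  \<comment> \<open>Applied once, the cycle rotates its own list by one position.\<close>
  have eq: "map (cycle_of_list xs) xs = tl xs @ [hd xs]"
    using cyclic_rotation[of xs 1] assms by (simp add: rotate1_hd_tl)
  have nth: "cycle_of_list xs (xs ! i) = (tl xs @ [hd xs]) ! i" if "i < length xs" for i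
    using that by (metis eq nth_map)
  show "successively (\<lambda>x y. cycle_of_list xs x = y) xs"
    by (auto simp: successively_conv_nth nth nth_append nth_tl)
  show "cycle_of_list xs (last xs) = hd xs"
    using assms nth[of "length xs - 1"] by (simp add: last_conv_nth nth_append)
qed

lemma support_successively:
  "successively (\<lambda>x y. p x = y) (support p a)"
  by (auto simp: successively_conv_nth)

section \<open>Tropical normal forms: paths, cycles and the adjoint\<close>

locale tropical_normal_form =
  fixes A :: "'g :: linordered_ab_group_add tropical mat" and n :: nat
  assumes carrier: "A \<in> carrier_mat n n" and normal: "normal_form A"
begin

lemma diag [simp]: "i < n \<Longrightarrow> A $$ (i, i) = 1"
  using carrier normal by (simp add: normal_form_def)

lemma permutation_weight_le_1:
  assumes "p permutes {0..<n}"
  shows "(\<Prod>r = 0..<n. A $$ (r, p r)) \<le> 1"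
proof -
  have "(\<Prod>r = 0..<n. A $$ (r, p r)) \<le> trop_det A"
    unfolding trop_det_def carrier_matD(1)[OF carrier] using assms
    by (intro member_le_sum[of p]) (auto simp: finite_permutations)
  then show ?thesis
    using normal by (simp add: normal_form_def)
qed

text \<open>The cycle along \<open>xs\<close> adds to the path only the closing edge at
  \<open>last xs\<close>, which the product omits, and loops of weight 1 at all other
  vertices.\<close>

lemma path_extension:
  assumes "distinct xs" "xs \<noteq> []" "set xs \<subseteq> {0..<n}"
  obtains p where "p permutes {0..<n}" "p (last xs) = hd xs"
    "path_weight A xs = (\<Prod>r\<in>{0..<n} - {last xs}. A $$ (r, p r))"
proof
  let ?p = "cycle_of_list xs"
  show "?p permutes {0..<n}"
    using cycle_permutes assms(3) by (rule permutes_subset)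
  show "?p (last xs) = hd xs"
    using assms by (simp add: cycle_of_list_successively)
  have "path_weight A xs = (\<Prod>r\<in>set xs - {last xs}. A $$ (r, ?p r))"
    using assms by (intro path_weight_eq_prod cycle_of_list_successively)
  also have "\<dots> = (\<Prod>r\<in>{0..<n} - {last xs}. A $$ (r, ?p r))"
  proof (rule prod.mono_neutral_left)
    show "\<forall>r \<in> {0..<n} - {last xs} - (set xs - {last xs}). A $$ (r, ?p r) = 1"
    proof
      fix r
      assume r: "r \<in> {0..<n} - {last xs} - (set xs - {last xs})"
      then have "cycle_of_list xs r = r"
        by (intro id_outside_supp) auto
      with r show "A $$ (r, ?p r) = 1"
        by simp
    qed
  qed (use assms in auto)
  finally show "path_weight A xs = (\<Prod>r\<in>{0..<n} - {last xs}. A $$ (r, ?p r))" .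
qed

text \<open>Multiplying by the closing edge completes the product of \<open>path_extension\<close>
  to the weight of a permutation.\<close>

lemma cycle_weight_le_1:
  assumes "distinct xs" "xs \<noteq> []" "set xs \<subseteq> {0..<n}"
  shows "path_weight A xs * A $$ (last xs, hd xs) \<le> 1"
proof -
  obtain p where p: "p permutes {0..<n}" "p (last xs) = hd xs"
    "path_weight A xs = (\<Prod>r\<in>{0..<n} - {last xs}. A $$ (r, p r))"
    using path_extension assms by blast
  have "last xs \<in> {0..<n}"
    using assms last_in_set by blast
  then have "(\<Prod>r = 0..<n. A $$ (r, p r)) = A $$ (last xs, hd xs) * path_weight A xs"
    using p by (simp add: prod.remove[of _ "last xs"])
  then show ?thesis
    using permutation_weight_le_1[OF p(1)] by (simp add: mult.commute)
qed

text \<open>The permutation of \<open>path_extension\<close> contributes one summand to this entry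
  of the adjoint.\<close>

lemma path_weight_le_adj:
  assumes "distinct xs" "xs \<noteq> []" "set xs \<subseteq> {0..<n}"
  shows "path_weight A xs \<le> trop_adj A $$ (hd xs, last xs)"
proof -
  obtain p where p: "p permutes {0..<n}" "p (last xs) = hd xs"
    "path_weight A xs = (\<Prod>r\<in>{0..<n} - {last xs}. A $$ (r, p r))"
    using path_extension assms by blast
  have less: "hd xs < n" "last xs < n"
    using assms by (auto dest: hd_in_set last_in_set)
  have "path_weight A xs \<le> trop_det (mat_delete A (last xs) (hd xs))"
    unfolding p(3) trop_det_mat_delete[OF carrier less] using p
    by (intro member_le_sum[of p]) (auto simp: finite_permutations)
  then show ?thesis
    using carrier less by (simp add: trop_adj_def)
qed

section \<open>Powers are bounded by the adjoint\<close>

lemma pow_Suc_index: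
  assumes "i < n" "j < n"
  shows "(A ^\<^sub>m Suc k) $$ (i, j) = (\<Sum>l = 0..<n. (A ^\<^sub>m k) $$ (i, l) * A $$ (l, j))"
  using assms carrier by (simp add: scalar_prod_def)

text \<open>Induction on the length: a new last vertex either keeps the path simple or closes a
  simple cycle, whose removal does not decrease the weight.\<close>

lemma pow_index_le_path:
  assumes "i < n" "j < n"
  shows "\<exists>xs. xs \<noteq> [] \<and> hd xs = i \<and> last xs = j \<and> distinct xs \<and> set xs \<subseteq> {0..<n} \<and>
    (A ^\<^sub>m k) $$ (i, j) \<le> path_weight A xs"
  using assms(2)
proof (induction k arbitrary: j)
  case 0
  show ?case
  proof (cases "i = j")
    case True
    then show ?thesis
      using 0 assms carrier by (intro exI[of _ "[i]"]) simp
  next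
    case False
    then show ?thesis
      \<comment> \<open>Off the diagonal \<open>A ^\<^sub>m 0\<close> is -infinity, so any simple
        path serves as a bound.\<close>
      using 0 assms carrier by (intro exI[of _ "[i, j]"]) simp
  qed
next
  case (Suc k)
  have "{0..<n} \<noteq> {}"
    using assms(1) by auto
  \<comment> \<open>The maximum is attained; \<open>l\<close> is the vertex before \<open>j\<close>
    on an optimal walk.\<close>
  then obtain l where "l \<in> {0..<n}"
    and Suc_eq: "(A ^\<^sub>m Suc k) $$ (i, j) = (A ^\<^sub>m k) $$ (i, l) * A $$ (l, j)"
    unfolding pow_Suc_index[OF assms(1) Suc.prems]
    by (rule tropical_sum_attained[OF finite_atLeastLessThan])
  then have l: "l < n"
    by simp
  obtain xs where xs: "xs \<noteq> []" "hd xs = i" "last xs = l" "distinct xs" "set xs \<subseteq> {0..<n}"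
    "(A ^\<^sub>m k) $$ (i, l) \<le> path_weight A xs"
    using Suc.IH[OF l] by blast
  have le: "(A ^\<^sub>m Suc k) $$ (i, j) \<le> path_weight A xs * A $$ (l, j)"
    unfolding Suc_eq using xs by (intro mult_right_mono) auto
  show ?case
  proof (cases "j \<in> set xs")
    case False
    then show ?thesis
      using le xs Suc.prems by (intro exI[of _ "xs @ [j]"]) (simp add: path_weight_snoc)
  next
    case True
    then obtain us vs where split: "xs = us @ j # vs"
      by (auto dest: split_list)
    \<comment> \<open>As \<open>l\<close> is the last vertex of \<open>j # vs\<close>, the edge from
      \<open>l\<close> to \<open>j\<close> closes this tail to a cycle, and \<open>us @ [j]\<close>
      remains.\<close>
    have "path_weight A xs * A $$ (l, j) =
        path_weight A (us @ [j]) * (path_weight A (j # vs) * A $$ (last (j # vs), hd (j # vs)))"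
      using path_weight_append[of A us j vs] xs split by (simp add: mult.assoc)
    also have "\<dots> \<le> path_weight A (us @ [j]) * 1"
      using xs split by (intro mult_left_mono cycle_weight_le_1) auto
    finally show ?thesis
      using le xs split by (intro exI[of _ "us @ [j]"]) (auto simp: hd_append)
  qed
qed

lemma pow_index_le_adj:
  assumes "i < n" "j < n"
  shows "(A ^\<^sub>m k) $$ (i, j) \<le> trop_adj A $$ (i, j)"
  using pow_index_le_path[OF assms, of k] path_weight_le_adj by force

section \<open>The adjoint is bounded by high powers\<close>

lemma pow_index_mult_le:
  assumes "i < n" "l < n" "j < n"
  shows "(A ^\<^sub>m k) $$ (i, l) * A $$ (l, j) \<le> (A ^\<^sub>m Suc k) $$ (i, j)"
  unfolding pow_Suc_index[OF assms(1,3)] using assms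
  by (intro member_le_sum[where f = "\<lambda>l. (A ^\<^sub>m k) $$ (i, l) * A $$ (l, j)"]) auto

text \<open>A loop of weight 1 at \<open>j\<close> lengthens a walk without changing its
  weight.\<close>

lemma pow_index_mono:
  assumes "i < n" "j < n" "k \<le> m"
  shows "(A ^\<^sub>m k) $$ (i, j) \<le> (A ^\<^sub>m m) $$ (i, j)"
  using assms(3)
proof (induction m rule: dec_induct)
  case (step m)
  then show ?case
    using pow_index_mult_le[of i j j m] assms by simp
qed simp

text \<open>The walk has one edge fewer than vertices and is among those over which the entry of the
  power is the maximum.\<close>

lemma path_weight_le_pow_index:
  assumes "xs \<noteq> []" "set xs \<subseteq> {0..<n}"
  shows "path_weight A xs \<le> (A ^\<^sub>m (length xs - 1)) $$ (hd xs, last xs)"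
  using assms
proof (induction xs rule: rev_induct)
  case (snoc y xs)
  show ?case
  proof (cases "xs = []")
    case True
    then show ?thesis
      using snoc.prems carrier by simp
  next
    case False
    have "path_weight A (xs @ [y]) \<le>
        (A ^\<^sub>m (length xs - 1)) $$ (hd xs, last xs) * A $$ (last xs, y)"
      using snoc False by (simp add: path_weight_snoc mult_right_mono)
    also have "\<dots> \<le> (A ^\<^sub>m Suc (length xs - 1)) $$ (hd xs, y)"
      using snoc.prems False hd_in_set[of xs] last_in_set[of xs]
      by (intro pow_index_mult_le) (auto simp: subset_iff)
    finally show ?thesis
      using False by (simp del: pow_mat.simps)
  qed
qed simp

lemma permutation_weight_le_pow:
  assumes p: "p permutes {0..<n}" and "p j = i" and "j < n" and "n - 1 \<le> k"
  shows "(\<Prod>r\<in>{0..<n} - {j}. A $$ (r, p r)) \<le> (A ^\<^sub>m k) $$ (i, j)"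
proof -
  \<comment> \<open>The orbit of \<open>i\<close>, listed as \<open>i\<close>, \<open>p i\<close>,
    and so on, is the path from \<open>i\<close> to \<open>j\<close>; \<open>?q\<close> keeps the
    other cycles of \<open>p\<close> and fixes this orbit.\<close>
  let ?xs = "support p i"
  let ?q = "\<lambda>y. if y \<in> {0..<n} - set ?xs then p y else y"
  have perm: "permutation p"
    using p permutation_permutes by blast
  have i: "i < n"
    using permutes_in_image[OF p, of j] assms by simp
  have pos: "least_power p i > 0" and cyc: "(p ^^ least_power p i) i = i"
    using least_power_of_permutation[OF perm] by blast+
  have ne: "?xs \<noteq> []" and hd: "hd ?xs = i"
    using pos by (simp_all add: hd_map)
  have dist: "distinct ?xs"
    using perm by (rule cycle_of_permutation)
  have sub: "set ?xs \<subseteq> {0..<n}"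
    using permutes_in_image[OF permutes_funpow[OF p]] i by auto
  \<comment> \<open>Applying \<open>p\<close> to the end of the orbit leads back to
    \<open>i\<close>, which is \<open>p j\<close>; injectivity then identifies the end with
    \<open>j\<close>.\<close>
  have "p (last ?xs) = (p ^^ Suc (least_power p i - 1)) i"
    using pos by (simp add: last_map del: Suc_pred)
  then have "p (last ?xs) = p j"
    using pos cyc assms(2) by (simp del: funpow.simps)
  then have last: "last ?xs = j"
    using permutes_inj[OF p] by (simp add: inj_eq)
  have "?q permutes {0..<n} - set ?xs"
    using p by (intro semidecomposition) auto
  then have "?q permutes {0..<n}"
    by (rule permutes_subset) auto
  then have "(\<Prod>r = 0..<n. A $$ (r, ?q r)) \<le> 1"
    by (rule permutation_weight_le_1)
  \<comment> \<open>On the orbit \<open>?q\<close> contributes diagonal entries only.\<close>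
  moreover have "(\<Prod>r\<in>{0..<n} - set ?xs. A $$ (r, p r)) = (\<Prod>r = 0..<n. A $$ (r, ?q r))"
    by (intro prod.mono_neutral_cong_left) auto
  ultimately have rest: "(\<Prod>r\<in>{0..<n} - set ?xs. A $$ (r, p r)) \<le> 1"
    by simp
  have "{0..<n} - {j} = ({0..<n} - set ?xs) \<union> (set ?xs - {j})"
    using sub ne last last_in_set[of ?xs] by blast
  then have "(\<Prod>r\<in>{0..<n} - {j}. A $$ (r, p r)) =
      (\<Prod>r\<in>{0..<n} - set ?xs. A $$ (r, p r)) * (\<Prod>r\<in>set ?xs - {j}. A $$ (r, p r))"
    by (simp only:) (subst prod.union_disjoint, auto)
  also have "\<dots> \<le> 1 * (\<Prod>r\<in>set ?xs - {j}. A $$ (r, p r))"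
    using rest by (rule mult_right_mono) simp
  also have "\<dots> = path_weight A ?xs"
    by (simp only: path_weight_eq_prod[OF dist support_successively ne] last mult_1_left)
  also have "\<dots> \<le> (A ^\<^sub>m (length ?xs - 1)) $$ (i, j)"
    using path_weight_le_pow_index[OF ne sub] hd last by simp
  also have "\<dots> \<le> (A ^\<^sub>m k) $$ (i, j)"
  proof (rule pow_index_mono)
    \<comment> \<open>At most \<open>n\<close> vertices means at most \<open>n - 1\<close> edges;
      here the bound on \<open>k\<close> enters.\<close>
    have "length ?xs \<le> n"
      using card_mono[OF _ sub] distinct_card[OF dist] by simp
    then show "length ?xs - 1 \<le> k"
      using assms by simp
  qed (use i assms in auto)
  finally show ?thesis .
qed

lemma adj_index_le_pow:
  assumes "i < n" "j < n" "n - 1 \<le> k"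
  shows "trop_adj A $$ (i, j) \<le> (A ^\<^sub>m k) $$ (i, j)"
  using assms carrier
  by (auto simp: trop_adj_def trop_det_mat_delete[OF carrier]
      intro!: tropical_sum_le permutation_weight_le_pow)

lemma nabla_eq_pow:
  assumes "n - 1 \<le> k"
  shows "nabla A = A ^\<^sub>m k"
  unfolding nabla_eq_adj[OF normal]
proof (rule eq_matI)
  fix i j
  assume "i < dim_row (A ^\<^sub>m k)" "j < dim_col (A ^\<^sub>m k)"
  then show "trop_adj A $$ (i, j) = (A ^\<^sub>m k) $$ (i, j)"
    using carrier assms
    by (intro antisym adj_index_le_pow pow_index_le_adj) (auto split: if_splits)
qed (use carrier in \<open>simp_all add: trop_adj_def\<close>)

end

section \<open>Transfer to the supertropical semiring\<close>

interpretation nu_level: comm_semiring_hom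
  "nu_level :: 'g :: linordered_ab_group_add supertropical \<Rightarrow> 'g tropical"
proof
  fix x y :: "'g supertropical"
  show "nu_level (x + y) = nu_level x + nu_level y"
    by (cases x; cases y) (auto simp: plus_supertropical_def plus_tropical_def max_def)
  show "nu_level (x * y) = nu_level x * nu_level y"
    by (cases x; cases y) auto
qed (simp_all add: zero_supertropical_def zero_tropical_def
    one_supertropical_def one_tropical_def)

text \<open>\<open>nu_level\<close> forgets exactly the distinction between tangible and ghost, so
  tropical equations between images pull back to equivalences.\<close>

lemma mat_nu_equiv_iff: "A \<cong>\<nu>\<^sub>m B \<longleftrightarrow> map_mat nu_level A = map_mat nu_level B"
  by (auto simp: mat_nu_equiv_def nu_equiv_def nu_eq_iff_nu_level_eq mat_eq_iff)

lemma (in comm_semiring_hom) hom_trop_det: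
  assumes "square_mat A"
  shows "hom (trop_det A) = trop_det (map_mat hom A)"
proof -
  \<comment> \<open>This index bound lets \<open>map_mat\<close> be evaluated at each
    factor.\<close>
  have "p r < dim_col A"
    if "p permutes {0..<dim_row A}" "r < dim_row A" for p r
    using that assms permutes_in_image[of p "{0..<dim_row A}" r] by simp
  then show ?thesis
    by (simp add: trop_det_def hom_sum hom_prod)
qed

lemma (in comm_semiring_hom) hom_trop_adj:
  assumes "square_mat A"
  shows "map_mat hom (trop_adj A) = trop_adj (map_mat hom A)"
proof (rule eq_matI)
  fix i j
  assume ij: "i < dim_row (trop_adj (map_mat hom A))" "j < dim_col (trop_adj (map_mat hom A))"
  have "map_mat hom (mat_delete A j i) = mat_delete (map_mat hom A) j i"
    using ij assms by (intro eq_matI) (auto simp: mat_delete_def trop_adj_def)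
  then show "map_mat hom (trop_adj A) $$ (i, j) = trop_adj (map_mat hom A) $$ (i, j)"
    using ij assms hom_trop_det[of "mat_delete A j i"] by (simp add: trop_adj_def)
qed (simp_all add: trop_adj_def)

lemma (in comm_semiring_hom) normal_form_map_mat:
  assumes "normal_form A"
  shows "normal_form (map_mat hom A)"
  using assms hom_trop_det[of A] by (simp add: normal_form_def)

text \<open>Both determinants are 1, so only the adjoint has to be transported.\<close>

lemma (in comm_semiring_hom) hom_nabla:
  assumes "normal_form A"
  shows "map_mat hom (nabla A) = nabla (map_mat hom A)"
proof -
  have "square_mat A"
    using assms by (simp add: normal_form_def)
  then show ?thesis
    using assms by (simp add: nabla_eq_adj normal_form_map_mat hom_trop_adj)
qed

theorem lemma6p7:
  fixes A :: "'g :: linordered_ab_group_add tropical mat"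
    and B :: "'g supertropical mat"
    and n :: nat
  shows "(A \<in> carrier_mat n n \<and> normal_form A \<longrightarrow>
           (\<forall>k \<ge> n - 1. nabla A = A ^\<^sub>m k) \<and>
           (\<forall>k \<ge> n - 1. A ^\<^sub>m k = A ^\<^sub>m (k + 1)))
       \<and> (B \<in> carrier_mat n n \<and> normal_form B \<longrightarrow>
           (\<forall>k \<ge> n - 1. nabla B \<cong>\<nu>\<^sub>m B ^\<^sub>m k) \<and>
           (\<forall>k \<ge> n - 1. B ^\<^sub>m k \<cong>\<nu>\<^sub>m B ^\<^sub>m (k + 1)))"
proof -
  have tropical: "nabla C = C ^\<^sub>m k"
    if "C \<in> carrier_mat n n" "normal_form C" "n - 1 \<le> k" for C :: "'g tropical mat" and k
    using that by (intro tropical_normal_form.nabla_eq_pow) (simp_all add: tropical_normal_form_def)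
  have supertropical: "nabla B \<cong>\<nu>\<^sub>m B ^\<^sub>m k"
    if B: "B \<in> carrier_mat n n" "normal_form B" and k: "n - 1 \<le> k" for k
    using tropical[of "map_mat nu_level B" k] B k
    by (simp add: mat_nu_equiv_iff nu_level.hom_nabla nu_level.mat_hom_pow[of _ n]
        nu_level.normal_form_map_mat)
  show ?thesis
  proof (intro conjI impI allI; elim conjE)
    fix k
    assume *: "n - 1 \<le> k"
    show "nabla A = A ^\<^sub>m k" if "A \<in> carrier_mat n n" "normal_form A"
      using tropical that * .
    show "A ^\<^sub>m k = A ^\<^sub>m (k + 1)" if "A \<in> carrier_mat n n" "normal_form A"
      \<comment> \<open>Both powers equal \<open>nabla A\<close>, since \<open>k + 1\<close> also
        satisfies the bound.\<close>
      using tropical[OF that, of k] tropical[OF that, of "k + 1"] * by simp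
    show "nabla B \<cong>\<nu>\<^sub>m B ^\<^sub>m k" if "B \<in> carrier_mat n n" "normal_form B"
      using supertropical that * .
    show "B ^\<^sub>m k \<cong>\<nu>\<^sub>m B ^\<^sub>m (k + 1)" if "B \<in> carrier_mat n n" "normal_form B"
      using supertropical[OF that, of k] supertropical[OF that, of "k + 1"] *
      by (simp add: mat_nu_equiv_iff)
  qed
qed

end
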